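(* Let $\Delta_u(d,n)$ denote the maximum diameter of the graph of a $d$-dimensional polyhedron with $n$ facets. For $\varepsilon > 0$ and $d \geq 3$, if $n \geq 2^{32d/\varepsilon^2}$, then $\Delta_u(d,n) \leq n^{1+\varepsilon}$.
   Context: A polyhedron is the intersection of finitely many closed halfspaces; $d$ is the dimension of its affine span and $n$ the number of its facets. The diameter is the maximum over pairs of vertices of the edge-distance in the graph (1-skeleton). *)

theory Defs
  imports "HOL-Analysis.Analysis"
begin

definition vertices :: "'a::euclidean_space set \<Rightarrow> 'a set" where
  "vertices P = {v. v extreme_point_of P}"

text \<open>Two vertices are adjacent in the graph (1-skeleton) iff the segment joining them is an edge.
  Unbounded edges (rays) contain only one vertex and contribute nothing.\<close>

definition skeleton :: "'a::euclidean_space set \<Rightarrow> ('a \<times> 'a) set" where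
  "skeleton P = {(v, w). v \<in> vertices P \<and> w \<in> vertices P \<and> closed_segment v w edge_of P}"

text \<open>The relation \<^const>\<open>skeleton\<close> is symmetric, so a walk of length \<open>k\<close> is membership in its
  \<open>k\<close>-th power. The distance is \<open>\<infinity>\<close> if there is no walk.\<close>

definition edge_dist :: "'a::euclidean_space set \<Rightarrow> 'a \<Rightarrow> 'a \<Rightarrow> enat" where
  "edge_dist P v w = (INF k \<in> {k. (v, w) \<in> skeleton P ^^ k}. enat k)"

text \<open>Diameter \<open>0\<close> if there are no vertices (i.e. if the polyhedron contains a line).\<close>

definition graph_diameter :: "'a::euclidean_space set \<Rightarrow> enat" where
  "graph_diameter P = (SUP v \<in> vertices P. SUP w \<in> vertices P. edge_dist P v w)"

text \<open>The polyhedra live in the ambient space \<open>'a\<close>, and their dimension is that of their affine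
  span. Up to affine isomorphism, every \<open>d\<close>-dimensional polyhedron occurs in each \<open>'a\<close> with
  \<open>d \<le> DIM('a)\<close>, so for all these \<open>'a\<close> the value is the same. A finite nonzero supremum in
  \<^typ>\<open>enat\<close> is attained, i.e. it is a maximum.\<close>

definition Delta_u :: "'a::euclidean_space itself \<Rightarrow> nat \<Rightarrow> nat \<Rightarrow> enat" where
  "Delta_u _ d n =
     (SUP P \<in> {P :: 'a set. polyhedron P \<and> aff_dim P = int d \<and> card {F. F facet_of P} = n}.
        graph_diameter P)"

end

theory Submission
  imports Defs
begin

text \<open>The argument of Kalai and Kleitman. If the balls of radius \<open>\<Delta>(d, \<lfloor>n / 2\<rfloor>) + 1\<close> around two vertices
  each meet more than half of the facets, they meet a common facet, within which one continues by
  induction on the dimension. If \<open>n < 2 ^ t\<close>, this yields \<open>\<Delta>(d, n) \<le> 2 ^ (t + 1) * C(d + t, d)\<close>, and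
  choosing \<open>x = d / log 2 n\<close> in \<open>C(d + t, d) \<le> (1 + x) ^ t * (1 + 1 / x) ^ d\<close> together with
  \<open>ln (1 + y) \<le> sqrt y\<close> gives the claim. Faces and subsets of facets are handled through an explicit
  description \<open>A \<inter> {x. a \<bullet> x \<le> b for (a, b) \<in> I}\<close> of the polyhedron, which need not be irredundant.\<close>

section \<open>Polyhedra presented by an affine set and finitely many inequalities; their
  vertices\<close>

text \<open>Equations sit in \<open>A\<close> and inequalities in \<open>I\<close>, so that both
  operations of the proof keep this form: making a constraint tight shrinks \<open>A\<close>, and
  relaxing the polyhedron shrinks \<open>I\<close>.\<close>

definition halfspace_int :: "'a::euclidean_space set \<Rightarrow> ('a \<times> real) set \<Rightarrow> 'a set" where
  "halfspace_int A I = {x \<in> A. \<forall>i\<in>I. fst i \<bullet> x \<le> snd i}"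

definition tight :: "'a::euclidean_space \<times> real \<Rightarrow> 'a \<Rightarrow> bool" where
  "tight i x \<longleftrightarrow> fst i \<bullet> x = snd i"

lemma halfspace_int_subset: "halfspace_int A I \<subseteq> A"
  by (auto simp: halfspace_int_def)

lemma halfspace_int_antimono: "K \<subseteq> I \<Longrightarrow> halfspace_int A I \<subseteq> halfspace_int A K"
  by (auto simp: halfspace_int_def)

lemma convex_halfspace_int:
  assumes "affine A"
  shows "convex (halfspace_int A I)"
proof -
  have "halfspace_int A I = A \<inter> (\<Inter>i\<in>I. {x. fst i \<bullet> x \<le> snd i})"
    by (auto simp: halfspace_int_def)
  then show ?thesis
    using assms by (simp add: convex_Int convex_INT affine_imp_convex convex_halfspace_le)
qed

lemma extreme_point_iff_no_symmetric_segment: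
  assumes "convex S"
  shows "x extreme_point_of S \<longleftrightarrow> x \<in> S \<and> (\<forall>u. x + u \<in> S \<and> x - u \<in> S \<longrightarrow> u = 0)"
proof (intro iffI conjI allI impI)
  assume x: "x extreme_point_of S"
  then show "x \<in> S" by (simp add: extreme_point_of_def)
  fix u assume u: "x + u \<in> S \<and> x - u \<in> S"
  have "x = midpoint (x + u) (x - u)"
    by (simp add: midpoint_def scaleR_2 [symmetric] algebra_simps)
  then have "x \<in> open_segment (x + u) (x - u) \<longleftrightarrow> x + u \<noteq> x - u"
    using midpoint_in_open_segment by metis
  with x u have "x + u = x - u" by (auto simp: extreme_point_of_def)
  then have "u + u = 0" by (simp add: algebra_simps eq_diff_eq)
  then show "u = 0" by (simp flip: scaleR_2)
next
  assume r: "x \<in> S \<and> (\<forall>u. x + u \<in> S \<and> x - u \<in> S \<longrightarrow> u = 0)"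
  have False if ab: "a \<in> S" "b \<in> S" and seg: "x \<in> open_segment a b" for a b
  proof -
    obtain s where s: "a \<noteq> b" "0 < s" "s < 1" "x = (1 - s) *\<^sub>R a + s *\<^sub>R b"
      using seg by (auto simp: in_segment)
    \<comment> \<open>This step length keeps both parameters \<open>s + m\<close> and
      \<open>s - m\<close> within \<open>[0, 1]\<close>, hence both points on the segment from
      \<open>a\<close> to \<open>b\<close>.\<close>
    define m where "m = min s (1 - s)"
    have m: "0 < m" "m \<le> s" "m \<le> 1 - s" using s by (auto simp: m_def)
    have "x + m *\<^sub>R (b - a) = (1 - (s + m)) *\<^sub>R a + (s + m) *\<^sub>R b"
      "x - m *\<^sub>R (b - a) = (1 - (s - m)) *\<^sub>R a + (s - m) *\<^sub>R b"
      by (simp_all add: s algebra_simps)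
    then have "x + m *\<^sub>R (b - a) \<in> S \<and> x - m *\<^sub>R (b - a) \<in> S"
      using m s ab assms by (auto intro!: convexD)
    with r have "m *\<^sub>R (b - a) = 0" by blast
    with m s show False by simp
  qed
  with r show "x extreme_point_of S" by (auto simp: extreme_point_of_def)
qed

lemma vertices_halfspace_int:
  assumes "affine A"
  shows "x \<in> vertices (halfspace_int A I) \<longleftrightarrow> x \<in> halfspace_int A I \<and>
    (\<forall>u. x + u \<in> halfspace_int A I \<and> x - u \<in> halfspace_int A I \<longrightarrow> u = 0)"
  by (simp add: vertices_def extreme_point_iff_no_symmetric_segment convex_halfspace_int assms)

lemma vertices_subset: "vertices P \<subseteq> P"
  by (auto simp: vertices_def extreme_point_of_def)

text \<open>Finitely many strict inequalities define an open condition on the step \<open>s\<close>,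
  so one \<open>e\<close> serves them all.\<close>

lemma non_tight_stable:
  fixes x u :: "'a::euclidean_space"
  assumes "finite J" "\<forall>i\<in>J. fst i \<bullet> x < snd i"
  obtains e where "0 < e" "\<And>s i. \<bar>s\<bar> \<le> e \<Longrightarrow> i \<in> J \<Longrightarrow> fst i \<bullet> (x + s *\<^sub>R u) < snd i"
proof -
  let ?T = "\<Inter>i\<in>J. {s. fst i \<bullet> (x + s *\<^sub>R u) < snd i}"
  have "open ?T"
    using assms(1) by (intro open_INT ballI open_Collect_less continuous_intros)
  moreover have "0 \<in> ?T" using assms by simp
  ultimately obtain e where "e > 0" "cball 0 e \<subseteq> ?T"
    using open_contains_cball by blast
  then show thesis using that[of e] by (auto simp: subset_iff)
qed

lemma symmetric_segment_shrink:
  assumes "convex S" "x + u \<in> S" "x - u \<in> S" "\<bar>s\<bar> \<le> 1"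
  shows "x + s *\<^sub>R u \<in> S"
proof -
  have "((1 + s) / 2) *\<^sub>R (x + u) + ((1 - s) / 2) *\<^sub>R (x - u)
      = ((1 + s) / 2 + (1 - s) / 2) *\<^sub>R x + ((1 + s) / 2 - (1 - s) / 2) *\<^sub>R u"
    by (simp only: scaleR_right_distrib scaleR_right_diff_distrib scaleR_left_distrib
        scaleR_left_diff_distrib) simp
  also have "\<dots> = x + s *\<^sub>R u" by (simp add: add_divide_distrib diff_divide_distrib)
  finally have "x + s *\<^sub>R u = ((1 + s) / 2) *\<^sub>R (x + u) + ((1 - s) / 2) *\<^sub>R (x - u)" ..
  also have "\<dots> \<in> S"
    using assms by (intro convexD) (auto simp: add_divide_distrib [symmetric])
  finally show ?thesis .
qed

text \<open>Constraints that are slack at \<open>x\<close> do not restrict small moves: a symmetric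
  segment around \<open>x\<close> in the larger polyhedron, once shrunk, fits into the smaller one,
  where \<open>x\<close> is a vertex.\<close>

lemma vertex_drop_non_tight:
  assumes "affine A" "finite I" "K \<subseteq> I" "x \<in> vertices (halfspace_int A I)"
    and nt: "\<forall>i\<in>I - K. \<not> tight i x"
  shows "x \<in> vertices (halfspace_int A K)"
proof -
  have x: "x \<in> halfspace_int A I" using assms vertices_subset by blast
  have "u = 0" if u: "x + u \<in> halfspace_int A K" "x - u \<in> halfspace_int A K" for u
  proof -
    have "\<forall>i\<in>I - K. fst i \<bullet> x < snd i"
      using x nt by (force simp: halfspace_int_def tight_def)
    then obtain e where e: "0 < e"
      "\<And>s i. \<bar>s\<bar> \<le> e \<Longrightarrow> i \<in> I - K \<Longrightarrow> fst i \<bullet> (x + s *\<^sub>R u) < snd i"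
      using non_tight_stable[of "I - K" x u] assms(2) by blast
    \<comment> \<open>The bound \<open>e\<close> protects the dropped constraints, the bound
      \<open>1\<close> keeps the move inside the given symmetric segment.\<close>
    define s where "s = min e 1"
    have s: "0 < s" "s \<le> e" "s \<le> 1" using e by (auto simp: s_def)
    have *: "x + r *\<^sub>R u \<in> halfspace_int A I" if r: "\<bar>r\<bar> \<le> s" for r
    proof -
      have "x + r *\<^sub>R u \<in> halfspace_int A K"
        using r s by (intro symmetric_segment_shrink u convex_halfspace_int assms) auto
      moreover have "fst i \<bullet> (x + r *\<^sub>R u) \<le> snd i" if "i \<in> I - K" for i
        using e(2)[of r i] that r s by linarith
      ultimately show ?thesis
        unfolding halfspace_int_def by blast
    qed
    have "x + s *\<^sub>R u \<in> halfspace_int A I" "x - s *\<^sub>R u \<in> halfspace_int A I"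
      using *[of s] *[of "- s"] s by auto
    then have "s *\<^sub>R u = 0"
      using assms(4) by (auto simp: vertices_halfspace_int assms(1))
    with s show "u = 0" by simp
  qed
  then show ?thesis
    using x halfspace_int_antimono[OF assms(3)] by (auto simp: vertices_halfspace_int assms(1))
qed

section \<open>The skeleton under passing to faces and under dropping constraints\<close>

lemma vertices_face_of: "F face_of P \<Longrightarrow> v \<in> vertices F \<longleftrightarrow> v \<in> vertices P \<and> v \<in> F"
  by (simp add: vertices_def extreme_point_of_face)

lemma skeleton_face_of: "F face_of P \<Longrightarrow> skeleton F \<subseteq> skeleton P"
  by (auto simp: skeleton_def vertices_face_of edge_of_def intro: face_of_trans)

lemma skeleton_sym: "(v, w) \<in> skeleton P \<Longrightarrow> (w, v) \<in> skeleton P"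
  by (simp add: skeleton_def closed_segment_commute)

lemma skeleton_relpow_sym: "(v, w) \<in> skeleton P ^^ k \<Longrightarrow> (w, v) \<in> skeleton P ^^ k"
proof (induction k arbitrary: w)
  case (Suc k)
  then show ?case by (meson relpow_Suc_E relpow_Suc_I2 skeleton_sym)
qed simp

lemma skeleton_relpow_vertices:
  "(v, w) \<in> skeleton P ^^ k \<Longrightarrow> v \<in> vertices P \<Longrightarrow> w \<in> vertices P"
proof (induction k arbitrary: w)
  case (Suc k)
  then obtain y where "(y, w) \<in> skeleton P" by (blast elim: relpow_Suc_E)
  then show ?case by (simp add: skeleton_def)
qed simp

lemma skeletonI:
  assumes "closed_segment v w face_of P" "v \<noteq> w"
  shows "(v, w) \<in> skeleton P"
proof -
  have "v \<in> vertices P" "w \<in> vertices P"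
    using extreme_point_of_face[OF assms(1)] by (auto simp: vertices_def extreme_point_of_segment)
  moreover have "aff_dim (closed_segment v w) = 1"
    using assms(2) by (simp add: segment_convex_hull aff_dim_convex_hull aff_dim_2)
  ultimately show ?thesis using assms by (simp add: skeleton_def edge_of_def)
qed

lemma skeleton_inside:
  assumes "(v, w) \<in> skeleton Q" "v \<in> P" "w \<in> P" "P \<subseteq> Q" "convex P"
  shows "(v, w) \<in> skeleton P"
proof -
  have "closed_segment v w face_of Q" "aff_dim (closed_segment v w) = 1"
    using assms(1) by (auto simp: skeleton_def edge_of_def)
  moreover have "closed_segment v w \<subseteq> P"
    using assms by (simp add: closed_segment_subset)
  ultimately show ?thesis
    using face_of_subset[of "closed_segment v w" Q P] assms
    by (auto intro!: skeletonI)
qed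

text \<open>Walk along the edge up to the last point \<open>z\<close> of the smaller polyhedron. The
  part of the edge up to \<open>z\<close> is a slice of a face, hence a face, and only a dropped
  constraint can stop the walk. The case \<open>z = v\<close> arises when the edge leaves at
  once.\<close>

lemma skeleton_exit:
  fixes v w :: "'a::euclidean_space"
  assumes "affine A" "finite I" "K \<subseteq> I"
    and vw: "(v, w) \<in> skeleton (halfspace_int A K)"
    and v: "v \<in> halfspace_int A I" and w: "w \<notin> halfspace_int A I"
  obtains z i where "z \<in> vertices (halfspace_int A I)" "i \<in> I - K" "tight i z"
    "z = v \<or> (v, z) \<in> skeleton (halfspace_int A I)"
proof -
  let ?P = "halfspace_int A I" and ?Q = "halfspace_int A K"
  let ?g = "\<lambda>t. v + t *\<^sub>R (w - v)"
  have PQ: "?P \<subseteq> ?Q" by (rule halfspace_int_antimono) fact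
  have E: "closed_segment v w face_of ?Q" using vw by (simp add: skeleton_def edge_of_def)
  have EQ: "closed_segment v w \<subseteq> ?Q" using E face_of_imp_subset by blast
  have seg: "?g t \<in> closed_segment v w" if "0 \<le> t" "t \<le> 1" for t
    using that by (auto simp: in_segment algebra_simps intro!: exI[of _ t])
  \<comment> \<open>The parameters of the edge points in the smaller polyhedron form a compact set,
    so a last one exists.\<close>
  let ?T = "{0..1} \<inter> (\<Inter>i\<in>I. {t. fst i \<bullet> ?g t \<le> snd i})"
  have T: "t \<in> ?T \<longleftrightarrow> 0 \<le> t \<and> t \<le> 1 \<and> ?g t \<in> ?P" for t
  proof -
    have "0 \<le> t \<Longrightarrow> t \<le> 1 \<Longrightarrow> ?g t \<in> A"
      using seg EQ halfspace_int_subset by blast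
    then show ?thesis by (auto simp: halfspace_int_def)
  qed
  have "compact ?T"
    by (intro compact_Int_closed closed_INT ballI closed_Collect_le continuous_intros) simp
  moreover have "0 \<in> ?T" unfolding T using v by simp
  ultimately obtain s where "s \<in> ?T" and s_max: "\<And>t. t \<in> ?T \<Longrightarrow> t \<le> s"
    using compact_attains_sup[of ?T] by blast
  then have s: "0 \<le> s" "s \<le> 1" "?g s \<in> ?P" unfolding T by blast+
  define z where "z = ?g s"
  have "s \<noteq> 1" using s w by auto
  with s have s1: "s < 1" by simp
  have zseg: "closed_segment v w \<inter> ?P = closed_segment v z"
  proof
    show "closed_segment v z \<subseteq> closed_segment v w \<inter> ?P"
      using seg[OF s(1,2)] s v convex_halfspace_int[OF assms(1), of I]
      unfolding z_def by (intro closed_segment_subset convex_Int) auto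
    show "closed_segment v w \<inter> ?P \<subseteq> closed_segment v z"
    proof
      fix y assume y: "y \<in> closed_segment v w \<inter> ?P"
      then obtain t where t: "0 \<le> t" "t \<le> 1" "y = ?g t"
        by (auto simp: in_segment algebra_simps)
      then have "t \<in> ?T" unfolding T using y by blast
      then have ts: "t \<le> s" by (rule s_max)
      show "y \<in> closed_segment v z"
      proof (cases "s = 0")
        case True
        then show ?thesis using t ts by simp
      next
        case False
        then have "y = (1 - t / s) *\<^sub>R v + (t / s) *\<^sub>R z" "0 \<le> t / s" "t / s \<le> 1"
          using s t ts by (auto simp: z_def algebra_simps)
        then show ?thesis by (auto simp: in_segment)
      qed
    qed
  qed
  have face: "closed_segment v z face_of ?P"
    using face_of_slice[OF E convex_halfspace_int[OF assms(1), of I]] PQ zseg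
    by (simp add: Int_absorb1)
  have "z \<in> vertices ?P"
    using extreme_point_of_face[OF face] by (auto simp: vertices_def extreme_point_of_segment)
  moreover have "\<exists>i\<in>I - K. tight i z"
  proof (rule ccontr)
    assume "\<not> ?thesis"
    then have "\<forall>i\<in>I - K. fst i \<bullet> z < snd i"
      using s(3) by (force simp: z_def tight_def halfspace_int_def)
    then obtain e where e: "0 < e"
      "\<And>r i. \<bar>r\<bar> \<le> e \<Longrightarrow> i \<in> I - K \<Longrightarrow> fst i \<bullet> (z + r *\<^sub>R (w - v)) < snd i"
      using non_tight_stable[of "I - K" z "w - v"] assms(2) by blast
    \<comment> \<open>With every dropped constraint slack at \<open>z\<close>, the walk could go on
      by \<open>r\<close>; the cap \<open>1 - s\<close> keeps it on the edge. This contradicts the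
      maximality of \<open>s\<close>.\<close>
    define r where "r = min e (1 - s)"
    have r: "0 < r" "r \<le> e" "s + r \<le> 1" using e s1 by (auto simp: r_def)
    have zr: "z + r *\<^sub>R (w - v) = ?g (s + r)"
      by (simp add: z_def scaleR_left_distrib)
    have "?g (s + r) \<in> ?Q" using seg[of "s + r"] r s EQ by auto
    moreover have "fst i \<bullet> ?g (s + r) \<le> snd i" if "i \<in> I - K" for i
      using e(2)[of r i] that r unfolding zr by linarith
    ultimately have "?g (s + r) \<in> ?P"
      unfolding halfspace_int_def by blast
    then have "s + r \<in> ?T" unfolding T using r s by simp
    then show False using s_max[of "s + r"] r by linarith
  qed
  moreover have "z = v \<or> (v, z) \<in> skeleton ?P"
    using skeletonI[OF face] by blast
  ultimately show thesis using that by blast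
qed

text \<open>As long as a path of the larger polyhedron stays inside the smaller one, its edges are
  edges there too. The first edge that leaves is cut off by \<open>skeleton_exit\<close>, which
  costs at most the one step of that edge.\<close>

lemma skeleton_path_exit:
  assumes "affine A" "finite I" "K \<subseteq> I"
    and "(v, y) \<in> skeleton (halfspace_int A K) ^^ l"
    and "v \<in> vertices (halfspace_int A I)"
  shows "y \<in> halfspace_int A I \<and> (v, y) \<in> skeleton (halfspace_int A I) ^^ l \<or>
    (\<exists>k z. k \<le> l \<and> (v, z) \<in> skeleton (halfspace_int A I) ^^ k \<and> (\<exists>i\<in>I - K. tight i z))"
  using assms(4)
proof (induction l arbitrary: y)
  case 0
  then show ?case using assms(5) vertices_subset by auto
next
  case (Suc l)
  let ?P = "halfspace_int A I" and ?Q = "halfspace_int A K"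
  from Suc.prems obtain x where x: "(v, x) \<in> skeleton ?Q ^^ l" "(x, y) \<in> skeleton ?Q"
    by auto
  consider "x \<in> ?P" "(v, x) \<in> skeleton ?P ^^ l" |
    "\<exists>k z. k \<le> l \<and> (v, z) \<in> skeleton ?P ^^ k \<and> (\<exists>i\<in>I - K. tight i z)"
    using Suc.IH[OF x(1)] by blast
  then show ?case
  proof cases
    case 1
    show ?thesis
    proof (cases "y \<in> ?P")
      case True
      then have "(x, y) \<in> skeleton ?P"
        using skeleton_inside[OF x(2) 1(1) True] assms
        by (simp add: halfspace_int_antimono convex_halfspace_int)
      with 1 True show ?thesis by (meson relpow_Suc_I)
    next
      case False
      obtain z i where "i \<in> I - K" "tight i z" "z = x \<or> (x, z) \<in> skeleton ?P"
        using skeleton_exit[OF assms(1-3) x(2) 1(1) False] by blast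
      moreover from this 1 have "(v, z) \<in> skeleton ?P ^^ l \<or> (v, z) \<in> skeleton ?P ^^ Suc l"
        by (metis relpow_Suc_I)
      ultimately show ?thesis by (meson le_SucI order_refl)
    qed
  next
    case 2
    then show ?thesis by (meson le_SucI)
  qed
qed

lemma halfspace_int_face:
  assumes "affine A" "i \<in> I"
  shows "halfspace_int (A \<inter> {x. tight i x}) (I - {i}) face_of halfspace_int A I"
proof -
  have "halfspace_int A I \<inter> {x. fst i \<bullet> x = snd i} face_of halfspace_int A I"
    using assms by (intro face_of_Int_supporting_hyperplane_le convex_halfspace_int)
      (auto simp: halfspace_int_def)
  moreover have "halfspace_int A I \<inter> {x. fst i \<bullet> x = snd i}
      = halfspace_int (A \<inter> {x. tight i x}) (I - {i})"
    using assms by (auto simp: halfspace_int_def tight_def)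
  ultimately show ?thesis by simp
qed

lemma affine_Int_tight: "affine A \<Longrightarrow> affine (A \<inter> {x. tight i x})"
  by (simp add: tight_def affine_Int affine_hyperplane)

lemma vertex_in_tight_face:
  assumes "affine A" "i \<in> I" "v \<in> vertices (halfspace_int A I)" "tight i v"
  shows "v \<in> vertices (halfspace_int (A \<inter> {x. tight i x}) (I - {i}))"
proof -
  have "v \<in> halfspace_int A I" using assms(3) vertices_subset by blast
  then have "v \<in> halfspace_int (A \<inter> {x. tight i x}) (I - {i})"
    using assms(4) by (auto simp: halfspace_int_def)
  then show ?thesis
    using vertices_face_of[OF halfspace_int_face[OF assms(1,2)]] assms(3) by blast
qed

section \<open>Connectedness of the skeleton\<close>

text \<open>The reflection of \<open>w\<close> in \<open>v\<close> also lies in \<open>A\<close>, so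
  an affine set with a vertex is a single point. This is what remains when no constraint is
  tight.\<close>

lemma affine_vertex_unique:
  assumes "affine A" "v \<in> vertices A" "w \<in> A"
  shows "w = v"
proof -
  have v: "v \<in> A" using assms vertices_subset by blast
  have "v + 1 *\<^sub>R (w - v) \<in> A" "v + (- 1) *\<^sub>R (w - v) \<in> A"
    using mem_affine_3_minus[OF assms(1) v assms(3) v] by blast+
  then have "w - v = 0"
    using assms(2) extreme_point_iff_no_symmetric_segment[OF affine_imp_convex[OF assms(1)]]
    unfolding vertices_def by (simp add: algebra_simps) (metis add_diff_cancel_left' diff_diff_eq2)
  then show ?thesis by simp
qed

lemma halfspace_int_empty: "halfspace_int A {} = A"
  by (simp add: halfspace_int_def)

text \<open>The last point of the polyhedron on the line is a vertex: since the line cuts out a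
  face, a segment around that point would lie on the line, and one of its ends would lie beyond the
  last point.\<close>

lemma line_face_end_vertex:
  fixes w u :: "'a::euclidean_space"
  assumes "affine A" "finite K" and w: "w \<in> halfspace_int A K" and wu: "w + u \<in> halfspace_int A K"
    and F: "halfspace_int A K \<inter> range (\<lambda>c. w + c *\<^sub>R u) face_of halfspace_int A K"
    and t0: "t0 \<ge> 0" "w + t0 *\<^sub>R u \<notin> halfspace_int A K"
  obtains s where "s \<ge> 1" "w + s *\<^sub>R u \<in> vertices (halfspace_int A K)"
    "\<And>t. w + t *\<^sub>R u \<in> halfspace_int A K \<Longrightarrow> t \<le> s"
proof -
  let ?Q = "halfspace_int A K"
  have cv: "convex ?Q" by (rule convex_halfspace_int) fact
  have line: "w + t *\<^sub>R u \<in> A" for t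
    using mem_affine_3_minus[OF assms(1), of w "w + u" w t] w wu halfspace_int_subset[of A K] by auto
  \<comment> \<open>Cutting the search off at \<open>t0\<close> makes it compact; by convexity no
    point of the polyhedron lies on the line beyond \<open>t0\<close>.\<close>
  let ?T = "{0..t0} \<inter> (\<Inter>i\<in>K. {t. fst i \<bullet> (w + t *\<^sub>R u) \<le> snd i})"
  have T: "t \<in> ?T \<longleftrightarrow> 0 \<le> t \<and> t \<le> t0 \<and> w + t *\<^sub>R u \<in> ?Q" for t
    using line by (auto simp: halfspace_int_def)
  have between: "w + t *\<^sub>R u \<in> ?Q" if "0 \<le> t" "t \<le> r" "w + r *\<^sub>R u \<in> ?Q" for t r
  proof (cases "r = 0")
    case True
    then show ?thesis using that w by simp
  next
    case False
    then have "w + t *\<^sub>R u = (1 - t / r) *\<^sub>R w + (t / r) *\<^sub>R (w + r *\<^sub>R u)"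
      by (simp add: algebra_simps)
    also have "\<dots> \<in> ?Q"
      using that w False by (intro convexD[OF cv]) auto
    finally show ?thesis .
  qed
  have "compact ?T"
    by (intro compact_Int_closed closed_INT ballI closed_Collect_le continuous_intros) simp
  moreover have "0 \<in> ?T" unfolding T using w t0 by simp
  ultimately obtain s where "s \<in> ?T" and s_max: "\<And>t. t \<in> ?T \<Longrightarrow> t \<le> s"
    using compact_attains_sup[of ?T] by blast
  then have s: "0 \<le> s" "s \<le> t0" "w + s *\<^sub>R u \<in> ?Q" unfolding T by blast+
  have max: "t \<le> s" if "w + t *\<^sub>R u \<in> ?Q" for t
  proof (cases "0 \<le> t")
    case True
    have "t \<le> t0" using between[of t0 t] that t0 by force
    then have "t \<in> ?T" unfolding T using that True by simp
    then show ?thesis by (rule s_max)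
  qed (use s in simp)
  have "s \<ge> 1" using max[of 1] wu by simp
  moreover have "q = 0" if q: "w + s *\<^sub>R u + q \<in> ?Q" "w + s *\<^sub>R u - q \<in> ?Q" for q
  proof (rule ccontr)
    assume "q \<noteq> 0"
    let ?e = "w + s *\<^sub>R u"
    have "?e = midpoint (?e + q) (?e - q)"
      by (simp add: midpoint_def scaleR_2 [symmetric] algebra_simps)
    moreover have "?e + q \<noteq> ?e - q"
    proof
      assume "?e + q = ?e - q"
      then have "2 *\<^sub>R q = 0" by (simp add: scaleR_2 algebra_simps eq_diff_eq)
      with \<open>q \<noteq> 0\<close> show False by simp
    qed
    ultimately have "?e \<in> open_segment (?e + q) (?e - q)"
      by (metis midpoint_in_open_segment)
    \<comment> \<open>Both ends of the segment have parameters at most \<open>s\<close>, yet these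
      average to \<open>s\<close>, so the segment degenerates.\<close>
    from face_ofD[OF F this q] obtain c c' where
      c: "?e + q = w + c *\<^sub>R u" "?e - q = w + c' *\<^sub>R u" using s(3) by blast
    have le: "c \<le> s" "c' \<le> s" using max[of c] max[of c'] q c by simp_all
    have qc: "q = (c - s) *\<^sub>R u" "q = (s - c') *\<^sub>R u"
      using c by (simp_all add: algebra_simps)
    then have "(c - s) *\<^sub>R u = (s - c') *\<^sub>R u" by metis
    then have "u = 0 \<or> c - s = s - c'" using scaleR_cancel_right by blast
    then show False
    proof
      assume "u = 0" then show False using qc \<open>q \<noteq> 0\<close> by simp
    next
      assume "c - s = s - c'" then have "c = s" using le by linarith
      then show False using qc \<open>q \<noteq> 0\<close> by simp
    qed
  qed
  then have "w + s *\<^sub>R u \<in> vertices ?Q"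
    using s(3) by (simp add: vertices_halfspace_int assms(1))
  ultimately show thesis using that max by blast
qed

text \<open>Dropping a constraint that is tight at a vertex \<open>w\<close> turns \<open>w\<close> into either a vertex or a
  relative interior point of an edge of the larger polyhedron.\<close>

lemma line_face_through_dropped_vertex:
  fixes w u :: "'a::euclidean_space"
  assumes "affine A" "finite I" "i \<in> I" and w: "w \<in> vertices (halfspace_int A I)"
    and i: "tight i w"
    and u: "w + u \<in> halfspace_int A (I - {i})" "w - u \<in> halfspace_int A (I - {i})" "u \<noteq> 0"
  shows "fst i \<bullet> u \<noteq> 0"
    and "halfspace_int A (I - {i}) \<inter> range (\<lambda>c. w + c *\<^sub>R u) face_of halfspace_int A (I - {i})"
proof -
  let ?P = "halfspace_int A I" and ?Q = "halfspace_int A (I - {i})"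
  have wP: "w \<in> ?P" using w vertices_subset by blast
  have wvert: "q = 0" if "w + q \<in> ?P" "w - q \<in> ?P" for q
    using w that by (simp add: vertices_halfspace_int assms(1))
  have PI: "y \<in> ?P" if "y \<in> ?Q" "fst i \<bullet> y \<le> snd i" for y
    using that by (auto simp: halfspace_int_def)
  \<comment> \<open>Were constraint \<open>i\<close> constant along \<open>u\<close>, then
    \<open>w + u\<close> and \<open>w - u\<close> would lie in the original polyhedron, where
    \<open>w\<close> is a vertex.\<close>
  show iu: "fst i \<bullet> u \<noteq> 0"
  proof
    assume "fst i \<bullet> u = 0"
    then have "w + u \<in> ?P" "w - u \<in> ?P"
      using u i by (auto intro!: PI simp: inner_add_right inner_diff_right tight_def)
    then show False using wvert u by blast
  qed
  define T where "T = {j \<in> I - {i}. tight j w}"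
  have Tu: "fst j \<bullet> u = 0" if "j \<in> T" for j
    using that u unfolding T_def halfspace_int_def tight_def
    by (force simp: inner_add_right inner_diff_right)
  \<comment> \<open>The face is cut out by the constraints other than \<open>i\<close> that are
    tight at \<open>w\<close>.\<close>
  have "?Q \<inter> range (\<lambda>c. w + c *\<^sub>R u) = {y \<in> ?Q. \<forall>j\<in>T. tight j y}"
  proof (intro equalityI subsetI)
    fix y assume "y \<in> ?Q \<inter> range (\<lambda>c. w + c *\<^sub>R u)"
    then show "y \<in> {y \<in> ?Q. \<forall>j\<in>T. tight j y}"
      using Tu by (auto simp: T_def tight_def inner_add_right)
  next
    fix y assume y: "y \<in> {y \<in> ?Q. \<forall>j\<in>T. tight j y}"
    \<comment> \<open>\<open>c\<close> is chosen so that the remainder \<open>q\<close> is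
      orthogonal to the normal of \<open>i\<close>. It is also orthogonal to the normals in
      \<open>T\<close>, and all other constraints are slack at \<open>w\<close>, so a small multiple
      of \<open>q\<close> gives a symmetric segment around the vertex \<open>w\<close>; hence
      \<open>q = 0\<close>.\<close>
    define c where "c = fst i \<bullet> (y - w) / (fst i \<bullet> u)"
    define q where "q = y - w - c *\<^sub>R u"
    have qi: "fst i \<bullet> q = 0" using iu by (simp add: q_def c_def inner_diff_right)
    have qT: "fst j \<bullet> q = 0" if "j \<in> T" for j
      using that y Tu[OF that] by (simp add: q_def T_def tight_def inner_diff_right)
    have qA: "w + r *\<^sub>R q \<in> A" for r
    proof -
      have A: "w \<in> A" "w + u \<in> A" "y \<in> A"
        using wP u y halfspace_int_subset by blast+
      have "w + (r * (- c)) *\<^sub>R (w + u - w) \<in> A"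
        using mem_affine_3_minus[OF assms(1)] A by blast
      then have "w + (r * (- c)) *\<^sub>R (w + u - w) + r *\<^sub>R (y - w) \<in> A"
        using mem_affine_3_minus[OF assms(1)] A by blast
      then show ?thesis by (simp add: q_def algebra_simps)
    qed
    have "\<forall>j\<in>I - {i} - T. fst j \<bullet> w < snd j"
      using wP by (force simp: T_def tight_def halfspace_int_def)
    then obtain e where e: "0 < e"
      "\<And>r j. \<bar>r\<bar> \<le> e \<Longrightarrow> j \<in> I - {i} - T \<Longrightarrow> fst j \<bullet> (w + r *\<^sub>R q) < snd j"
      using non_tight_stable[of "I - {i} - T" w q] assms(2) by blast
    have "w + r *\<^sub>R q \<in> ?P" if r: "\<bar>r\<bar> \<le> e" for r
    proof -
      have "fst j \<bullet> (w + r *\<^sub>R q) \<le> snd j" if j: "j \<in> I" for j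
      proof (cases "j = i \<or> j \<in> T")
        case True
        then show ?thesis using qi qT i by (auto simp: inner_add_right T_def tight_def)
      next
        case False
        then show ?thesis using e(2)[OF r, of j] j by auto
      qed
      then show ?thesis using qA by (simp add: halfspace_int_def)
    qed
    from this[of e] this[of "- e"] have "w + e *\<^sub>R q \<in> ?P" "w - e *\<^sub>R q \<in> ?P"
      using e(1) by auto
    then have "e *\<^sub>R q = 0" by (rule wvert)
    then have "q = 0" using e by simp
    then have "y = w + c *\<^sub>R u" by (simp add: q_def algebra_simps)
    then show "y \<in> ?Q \<inter> range (\<lambda>c. w + c *\<^sub>R u)" using y by blast
  qed
  moreover have "{y \<in> ?Q. \<forall>j\<in>T. tight j y} face_of ?Q"
  proof (cases "T = {}")
    case True
    then show ?thesis by (simp add: face_of_refl convex_halfspace_int assms(1))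
  next
    case False
    have "?Q \<inter> {y. fst j \<bullet> y = snd j} face_of ?Q" if "j \<in> T" for j
      using that by (intro face_of_Int_supporting_hyperplane_le convex_halfspace_int assms(1))
        (auto simp: T_def halfspace_int_def)
    then have "(\<Inter>j\<in>T. ?Q \<inter> {y. fst j \<bullet> y = snd j}) face_of ?Q"
      using False by (intro face_of_Inter) auto
    moreover have "(\<Inter>j\<in>T. ?Q \<inter> {y. fst j \<bullet> y = snd j}) = {y \<in> ?Q. \<forall>j\<in>T. tight j y}"
      using False by (auto simp: tight_def)
    ultimately show ?thesis by simp
  qed
  ultimately show "?Q \<inter> range (\<lambda>c. w + c *\<^sub>R u) face_of ?Q" by simp
qed

text \<open>Induction over the constraints. Suppose \<open>w\<close> is unreachable and
  \<open>i\<close> is tight at \<open>w\<close>. By induction in the face of \<open>i\<close>, no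
  vertex reachable from \<open>v\<close> is tight at \<open>i\<close>. After dropping
  \<open>i\<close>, paths from \<open>v\<close> therefore never leave the polyhedron, so every
  vertex of the larger one is reachable. Then \<open>w\<close> is none of these, but an edge joins
  it to one of them.\<close>

lemma skeleton_connected:
  fixes A :: "'a::euclidean_space set"
  assumes "finite I" "affine A"
    and "v \<in> vertices (halfspace_int A I)" "w \<in> vertices (halfspace_int A I)"
  shows "(v, w) \<in> (skeleton (halfspace_int A I))\<^sup>*"
  using assms
proof (induction I arbitrary: A v w rule: finite_psubset_induct)
  case (psubset I)
  let ?P = "halfspace_int A I"
  note A = \<open>affine A\<close>
  have vP: "v \<in> ?P" and wP: "w \<in> ?P" using psubset.prems vertices_subset by blast+
  show ?case
  proof (cases "\<exists>i\<in>I. tight i w")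
    case False
    then have "w \<in> vertices (halfspace_int A {})"
      using vertex_drop_non_tight[OF A psubset.hyps(1) _ psubset.prems(3), of "{}"] by simp
    then have "v = w"
      using affine_vertex_unique[OF A, of w v] vP by (simp add: halfspace_int_def)
    then show ?thesis by simp
  next
    case True
    then obtain i where i: "i \<in> I" "tight i w" by blast
    let ?Q = "halfspace_int A (I - {i})" and ?F = "halfspace_int (A \<inter> {x. tight i x}) (I - {i})"
    have smaller: "I - {i} \<subset> I" using i by blast
    have PQ: "?P \<subseteq> ?Q" by (rule halfspace_int_antimono) blast
    show ?thesis
    proof (rule ccontr)
      assume nconn: "(v, w) \<notin> (skeleton ?P)\<^sup>*"
      have apart: "\<not> tight i y" if y: "(v, y) \<in> (skeleton ?P)\<^sup>*" for y
      proof
        assume "tight i y"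
        moreover from y have "y \<in> vertices ?P"
          using skeleton_relpow_vertices psubset.prems(2) by (auto simp: rtrancl_power)
        ultimately have "y \<in> vertices ?F" "w \<in> vertices ?F"
          using vertex_in_tight_face A i psubset.prems(3) by blast+
        then have "(y, w) \<in> (skeleton ?F)\<^sup>*"
          by (intro psubset.IH smaller affine_Int_tight A)
        then have "(y, w) \<in> (skeleton ?P)\<^sup>*"
          using rtrancl_mono[OF skeleton_face_of[OF halfspace_int_face[OF A i(1)]]] by blast
        with y nconn show False by (meson rtrancl_trans)
      qed
      have "v \<in> vertices ?Q"
        using vertex_drop_non_tight[OF A psubset.hyps(1) _ psubset.prems(2), of "I - {i}"] apart
        by auto
      have reach: "e \<in> ?P \<and> (v, e) \<in> (skeleton ?P)\<^sup>*" if e: "e \<in> vertices ?Q" for e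
      proof -
        have "(v, e) \<in> (skeleton ?Q)\<^sup>*"
          by (intro psubset.IH smaller A \<open>v \<in> vertices ?Q\<close> e)
        then obtain l where "(v, e) \<in> skeleton ?Q ^^ l" by (auto simp: rtrancl_power)
        from skeleton_path_exit[OF A psubset.hyps(1) _ this psubset.prems(2)]
        show ?thesis using apart by (auto simp: rtrancl_power)
      qed
      have "w \<notin> vertices ?Q" using reach nconn by blast
      then obtain u0 where u0: "w + u0 \<in> ?Q" "w - u0 \<in> ?Q" "u0 \<noteq> 0"
        using wP PQ by (auto simp: vertices_halfspace_int A)
      have "fst i \<bullet> u0 \<noteq> 0"
        using line_face_through_dropped_vertex(1)[OF A psubset.hyps(1) i(1) psubset.prems(3) i(2) u0] .
      \<comment> \<open>Orient the line so that it enters the halfspace of \<open>i\<close>; then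
        its nonnegative side is the part allowed by that constraint.\<close>
      obtain u where u: "w + u \<in> ?Q" "w - u \<in> ?Q" "u \<noteq> 0" and iu: "fst i \<bullet> u < 0"
      proof (cases "fst i \<bullet> u0 < 0")
        case True
        then show ?thesis using that u0 by blast
      next
        case False
        then show ?thesis using that[of "- u0"] u0 \<open>fst i \<bullet> u0 \<noteq> 0\<close> by simp
      qed
      have F: "?Q \<inter> range (\<lambda>c. w + c *\<^sub>R u) face_of ?Q"
        using line_face_through_dropped_vertex(2)[OF A psubset.hyps(1) i(1) psubset.prems(3) i(2) u] .
      have neg: "range (\<lambda>c. w + c *\<^sub>R - u) = range (\<lambda>c. w + c *\<^sub>R u)"
        by (auto simp: image_def) (metis minus_minus scaleR_minus_left)+
      have inQP: "w + t *\<^sub>R u \<in> ?P \<longleftrightarrow> w + t *\<^sub>R u \<in> ?Q \<and> 0 \<le> t" for t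
      proof -
        have "y \<in> ?P \<longleftrightarrow> y \<in> ?Q \<and> fst i \<bullet> y \<le> snd i" for y
          using i by (auto simp: halfspace_int_def)
        then show ?thesis
          using i(2) iu by (simp add: inner_add_right tight_def mult_le_0_iff)
      qed
      \<comment> \<open>Otherwise every remaining constraint is constant along \<open>u\<close>, and
        \<open>v\<close> could be moved both ways along \<open>u\<close> although it is a vertex of
        the larger polyhedron.\<close>
      have "\<exists>t. w + t *\<^sub>R u \<notin> ?Q"
      proof (rule ccontr)
        assume all: "\<not> ?thesis"
        have zero: "fst j \<bullet> u = 0" if j: "j \<in> I - {i}" for j
        proof (rule ccontr)
          assume nz: "fst j \<bullet> u \<noteq> 0"
          define t where "t = (snd j - fst j \<bullet> w + 1) / (fst j \<bullet> u)"
          have "fst j \<bullet> (w + t *\<^sub>R u) \<le> snd j" using all j by (auto simp: halfspace_int_def)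
          then show False using nz by (simp add: t_def inner_add_right)
        qed
        have vA: "v \<in> A" "w \<in> A" "w + u \<in> A" using vP wP u halfspace_int_subset by blast+
        then have "v + 1 *\<^sub>R (w + u - w) \<in> A" "v + (- 1) *\<^sub>R (w + u - w) \<in> A"
          using mem_affine_3_minus[OF A] by blast+
        moreover have "v \<in> ?Q" using vP PQ by blast
        ultimately have "v + u \<in> ?Q" "v - u \<in> ?Q"
          using zero by (auto simp: halfspace_int_def inner_add_right inner_diff_right)
        then have "u = 0" using \<open>v \<in> vertices ?Q\<close> by (simp add: vertices_halfspace_int A)
        with u show False by simp
      qed
      then obtain t where t: "w + t *\<^sub>R u \<notin> ?Q" by blast
      show False
      proof (cases "t \<ge> 0")
        case True
        obtain s where s: "s \<ge> 1" "w + s *\<^sub>R u \<in> vertices ?Q"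
          "\<And>t. w + t *\<^sub>R u \<in> ?Q \<Longrightarrow> t \<le> s"
          using line_face_end_vertex[OF A _ _ u(1) F True t] psubset.hyps(1) wP PQ by blast
        define e where "e = w + s *\<^sub>R u"
        have e: "e \<in> ?P" "(v, e) \<in> (skeleton ?P)\<^sup>*" using reach s(2) by (auto simp: e_def)
        \<comment> \<open>The half of the line that survives constraint \<open>i\<close> is the
          segment from \<open>w\<close> to the reachable vertex \<open>e\<close>, which is thus an
          edge.\<close>
        have "?Q \<inter> range (\<lambda>c. w + c *\<^sub>R u) \<inter> ?P = closed_segment w e"
        proof (intro equalityI subsetI)
          fix y assume "y \<in> ?Q \<inter> range (\<lambda>c. w + c *\<^sub>R u) \<inter> ?P"
          then obtain c where c: "y = w + c *\<^sub>R u" "0 \<le> c" "c \<le> s" using inQP s(3) by blast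
          then have "y = (1 - c / s) *\<^sub>R w + (c / s) *\<^sub>R e"
            using s(1) by (simp add: e_def algebra_simps)
          then show "y \<in> closed_segment w e"
            using c s(1) by (auto simp: in_segment intro!: exI[of _ "c / s"])
        next
          fix y assume y: "y \<in> closed_segment w e"
          then have "y \<in> ?P"
            using closed_segment_subset[OF wP e(1)] convex_halfspace_int[OF A] by blast
          moreover from y obtain c where "y = (1 - c) *\<^sub>R w + c *\<^sub>R e" by (auto simp: in_segment)
          then have "y = w + (c * s) *\<^sub>R u" by (simp add: e_def algebra_simps)
          ultimately show "y \<in> ?Q \<inter> range (\<lambda>c. w + c *\<^sub>R u) \<inter> ?P" using PQ by blast
        qed
        then have "closed_segment w e face_of ?P"
          using face_of_slice[OF F convex_halfspace_int[OF A, of I]] PQ by (simp add: Int_absorb1)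
        moreover have "w \<noteq> e" using s(1) u(3) by (simp add: e_def)
        ultimately have "(w, e) \<in> skeleton ?P" by (rule skeletonI)
        then have "(e, w) \<in> skeleton ?P" by (rule skeleton_sym)
        with e(2) nconn show False by (meson rtrancl.rtrancl_into_rtrancl)
      next
        case False
        \<comment> \<open>Here the line ends on its negative side. The vertex at that end violates
          constraint \<open>i\<close>, contrary to \<open>reach\<close>.\<close>
        have "w + - u \<in> ?Q" "- t \<ge> 0" "w + (- t) *\<^sub>R (- u) \<notin> ?Q" "finite (I - {i})" "w \<in> ?Q"
          using u(2) t False psubset.hyps(1) wP PQ by auto
        then obtain s where s: "s \<ge> 1" "w + s *\<^sub>R (- u) \<in> vertices ?Q"
          using line_face_end_vertex[OF A _ _ _ F[folded neg]] by metis
        then have "w + (- s) *\<^sub>R u \<in> ?P" using reach by auto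
        then have "0 \<le> - s" using inQP by blast
        then show False using s(1) by simp
      qed
    qed
  qed
qed

section \<open>The recursion for the diameter\<close>

text \<open>After this reduction, making any remaining constraint tight strictly lowers the
  dimension of the affine set.\<close>

lemma halfspace_int_drop_redundant:
  "halfspace_int A {i \<in> I. \<not> A \<subseteq> {x. tight i x}} = halfspace_int A I"
  by (fastforce simp: halfspace_int_def tight_def)

text \<open>If fewer than \<open>2 ^ t\<close> constraints were tight in the ball, drop all others: a short path to \<open>y\<close> in
  the larger polyhedron cannot leave the original one, as it would exit through a dropped constraint
  that is tight at some vertex of the ball.\<close>

lemma many_tight_constraints_in_ball:
  fixes A :: "'a::euclidean_space set"
  assumes "affine A" "finite I"
    and v: "v \<in> vertices (halfspace_int A I)"
    and y: "(v, y) \<in> skeleton (halfspace_int A I) ^^ Suc r"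
    and far: "\<And>k. k \<le> r \<Longrightarrow> (v, y) \<notin> skeleton (halfspace_int A I) ^^ k"
    and small: "\<And>K a b. K \<subseteq> I \<Longrightarrow> card K < 2 ^ t \<Longrightarrow> a \<in> vertices (halfspace_int A K) \<Longrightarrow>
      b \<in> vertices (halfspace_int A K) \<Longrightarrow> \<exists>k\<le>r. (a, b) \<in> skeleton (halfspace_int A K) ^^ k"
  shows "2 ^ t \<le> card {i \<in> I. \<exists>k z. k \<le> Suc r \<and>
      (v, z) \<in> skeleton (halfspace_int A I) ^^ k \<and> tight i z}"
    (is "_ \<le> card ?R")
proof (rule ccontr)
  assume less: "\<not> 2 ^ t \<le> card ?R"
  let ?P = "halfspace_int A I" and ?Q = "halfspace_int A ?R"
  have R: "?R \<subseteq> I" by blast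
  have not_tight: "\<forall>i\<in>I - ?R. \<not> tight i z" if "k \<le> Suc r" "(v, z) \<in> skeleton ?P ^^ k" for k z
    using that by blast
  have "(v, v) \<in> skeleton ?P ^^ 0" by simp
  then have vQ: "v \<in> vertices ?Q"
    by (intro vertex_drop_non_tight[OF assms(1,2) R v] not_tight[of 0]) simp_all
  have "y \<in> vertices ?P" by (rule skeleton_relpow_vertices[OF y v])
  then have yQ: "y \<in> vertices ?Q"
    by (rule vertex_drop_non_tight[OF assms(1,2) R]) (rule not_tight[OF order_refl y])
  obtain l where l: "l \<le> r" "(v, y) \<in> skeleton ?Q ^^ l"
    using small[OF R _ vQ yQ] less by auto
  from skeleton_path_exit[OF assms(1,2) R l(2) v] show False
  proof
    assume "y \<in> ?P \<and> (v, y) \<in> skeleton ?P ^^ l"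
    then show False using far l(1) by blast
  next
    assume "\<exists>k z. k \<le> l \<and> (v, z) \<in> skeleton ?P ^^ k \<and> (\<exists>i\<in>I - ?R. tight i z)"
    then show False using not_tight l(1) by (meson le_SucI le_trans)
  qed
qed

lemma relpow_mono:
  fixes R S :: "('b \<times> 'b) set"
  assumes "R \<subseteq> S"
  shows "R ^^ k \<subseteq> S ^^ k"
  using assms by (induction k) auto

text \<open>A point reached after \<open>r\<close> steps of a shortest path is at distance exactly
  \<open>r\<close>, since a shortcut to it would shorten the whole path.\<close>

lemma shortest_relpow_split:
  fixes R :: "('b \<times> 'b) set"
  assumes "(v, w) \<in> R ^^ l" "\<And>k. (v, w) \<in> R ^^ k \<Longrightarrow> l \<le> k" "r \<le> l"
  obtains y where "(v, y) \<in> R ^^ r" "\<And>k. k < r \<Longrightarrow> (v, y) \<notin> R ^^ k"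
proof -
  have "(v, w) \<in> R ^^ r O R ^^ (l - r)"
    using assms(1,3) by (simp flip: relpow_add)
  then obtain y where y: "(v, y) \<in> R ^^ r" "(y, w) \<in> R ^^ (l - r)" by blast
  moreover have "(v, y) \<notin> R ^^ k" if "k < r" for k
  proof
    assume "(v, y) \<in> R ^^ k"
    with y(2) have "(v, w) \<in> R ^^ (k + (l - r))" by (auto simp: relpow_add)
    then have "l \<le> k + (l - r)" by (rule assms(2))
    with that assms(3) show False by simp
  qed
  ultimately show thesis using that by blast
qed

text \<open>The recursion \<open>\<Delta>(d, n) \<le> \<Delta>(d - 1, n - 1) + 2 \<Delta>(d, \<lfloor>n / 2\<rfloor>) + 2\<close> of Kalai and Kleitman, solved
  along \<open>n < 2 ^ t\<close>. The summand \<open>2\<close> on the left absorbs the additive constant.\<close>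

lemma skeleton_distance_bound:
  fixes A :: "'a::euclidean_space set"
  assumes "finite I" "affine A" "card I < 2 ^ t" "aff_dim A \<le> int d"
    and "v \<in> vertices (halfspace_int A I)" "w \<in> vertices (halfspace_int A I)"
  shows "\<exists>k. k + 2 \<le> 2 ^ (t + 1) * ((d + t) choose d) \<and> (v, w) \<in> skeleton (halfspace_int A I) ^^ k"
  using assms
proof (induction t arbitrary: d A I v w)
  case 0
  then have "I = {}" by auto
  with 0 have "w = v"
    by (metis affine_vertex_unique halfspace_int_empty subsetD vertices_subset)
  then show ?case by (intro exI[of _ 0]) simp
next
  case (Suc t)
  note t_IH = Suc.IH
  show ?case using Suc.prems
  proof (induction d arbitrary: A I v w)
    case 0
    have vw: "v \<in> A" "w \<in> A" using 0 vertices_subset halfspace_int_subset by blast+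
    then have "A \<noteq> {}" by blast
    then have "aff_dim A = 0" using 0(4) aff_dim_negative_iff[of A] by linarith
    then have "w = v" using vw aff_dim_eq_0[of A] by auto
    moreover have "(2::nat) ^ 1 \<le> 2 ^ (Suc t + 1)" by (rule power_increasing) simp_all
    then have "0 + 2 \<le> (2::nat) ^ (Suc t + 1) * ((0 + Suc t) choose 0)"
      by (simp only: binomial_n_0 power_one_right mult_1_right add_0)
    ultimately show ?case by (intro exI[of _ 0]) (simp only: relpow_0_I simp_thms)
  next
    case (Suc d)
    let ?P = "halfspace_int A I"
    \<comment> \<open>\<open>D\<close> is the bound for half as many constraints in the same
      dimension, \<open>D'\<close> the one for the same \<open>t\<close> in one dimension less;
      Pascal's rule combines them to \<open>2 * D + D'\<close>.\<close>
    define D where "D = (2::nat) ^ (t + 1) * ((Suc d + t) choose Suc d)"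
    define D' where "D' = (2::nat) ^ (Suc t + 1) * ((d + Suc t) choose d)"
    have "(0::nat) < (Suc d + t) choose Suc d" by (simp add: zero_less_binomial_iff)
    then have "2 * 1 \<le> (2 * 2 ^ t) * ((Suc d + t) choose Suc d)"
      by (intro mult_le_mono) (simp_all add: Suc_le_eq)
    then have D2: "2 \<le> D" by (simp add: D_def)
    have rec: "2 ^ (Suc t + 1) * ((Suc d + Suc t) choose Suc d) = 2 * D + D'"
      by (simp add: D_def D'_def algebra_simps)
    define J where "J = {i \<in> I. \<not> A \<subseteq> {x. tight i x}}"
    have J: "finite J" "halfspace_int A J = ?P"
      using Suc.prems(1) halfspace_int_drop_redundant by (auto simp: J_def)
    have "card J \<le> card I" using Suc.prems(1) by (intro card_mono) (auto simp: J_def)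
    then have Jcard: "card J < 2 ^ Suc t" using Suc.prems(3) by simp
    define S where "S = skeleton ?P"
    have v: "v \<in> vertices (halfspace_int A J)" and w: "w \<in> vertices (halfspace_int A J)"
      using Suc.prems J by simp_all
    obtain l0 where "(v, w) \<in> S ^^ l0"
      using skeleton_connected[OF Suc.prems(1,2,5,6)] by (auto simp: rtrancl_power S_def)
    define l where "l = (LEAST l. (v, w) \<in> S ^^ l)"
    have l: "(v, w) \<in> S ^^ l" unfolding l_def by (rule LeastI) fact
    have least: "l \<le> k" if "(v, w) \<in> S ^^ k" for k
      unfolding l_def using that by (rule Least_le)
    have S_sym: "(a, b) \<in> S ^^ k \<longleftrightarrow> (b, a) \<in> S ^^ k" for a b k
      unfolding S_def using skeleton_relpow_sym by blast
    show ?case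
    proof (cases "l \<le> D - 1")
      case True
      then show ?thesis using l D2 unfolding rec S_def by (intro exI[of _ l]) simp
    next
      case False
      \<comment> \<open>The induction hypothesis bounds distances by \<open>D - 2\<close>, so balls
        of radius \<open>D - 1\<close> are the first to which
        \<open>many_tight_constraints_in_ball\<close> applies. As \<open>l\<close> is at least
        \<open>D - 1\<close>, both ends have a vertex at exactly that distance.\<close>
      have SucD: "Suc (D - 2) = D - 1" using D2 by simp
      have small: "\<exists>k\<le>D - 2. (a, b) \<in> skeleton (halfspace_int A K) ^^ k"
        if K: "K \<subseteq> J" "card K < 2 ^ t"
          and ab: "a \<in> vertices (halfspace_int A K)" "b \<in> vertices (halfspace_int A K)" for K a b
      proof -
        have "finite K" using K J(1) finite_subset by blast
        from t_IH[OF this Suc.prems(2) K(2) Suc.prems(4) ab]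
        obtain k where "k + 2 \<le> D" "(a, b) \<in> skeleton (halfspace_int A K) ^^ k"
          by (auto simp: D_def)
        then show ?thesis by (intro exI[of _ k]) auto
      qed
      define R where "R x = {i \<in> J. \<exists>k z. k \<le> D - 1 \<and> (x, z) \<in> S ^^ k \<and> tight i z}" for x
      have many: "2 ^ t \<le> card (R x)"
        if x: "x \<in> vertices (halfspace_int A J)" "(x, y) \<in> S ^^ (D - 1)"
          "\<And>k. k < D - 1 \<Longrightarrow> (x, y) \<notin> S ^^ k" for x y
      proof -
        have "(x, y) \<in> skeleton (halfspace_int A J) ^^ Suc (D - 2)"
          using x(2) by (simp add: J(2) S_def SucD del: relpow.simps)
        moreover have "(x, y) \<notin> skeleton (halfspace_int A J) ^^ k" if "k \<le> D - 2" for k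
          using x(3)[of k] that SucD by (simp add: J(2) S_def)
        ultimately show ?thesis
          using many_tight_constraints_in_ball[OF Suc.prems(2) J(1) x(1) _ _ small]
          unfolding R_def S_def SucD J(2) by blast
      qed
      have "D - 1 \<le> l" using False by simp
      obtain y where "(v, y) \<in> S ^^ (D - 1)" "\<And>k. k < D - 1 \<Longrightarrow> (v, y) \<notin> S ^^ k"
        using shortest_relpow_split[OF l least \<open>D - 1 \<le> l\<close>] by blast
      then have Rv: "2 ^ t \<le> card (R v)" by (rule many[OF v])
      have l': "(w, v) \<in> S ^^ l" "\<And>k. (w, v) \<in> S ^^ k \<Longrightarrow> l \<le> k"
        using l least S_sym by blast+
      obtain y where "(w, y) \<in> S ^^ (D - 1)" "\<And>k. k < D - 1 \<Longrightarrow> (w, y) \<notin> S ^^ k"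
        using shortest_relpow_split[OF l' \<open>D - 1 \<le> l\<close>] by blast
      then have Rw: "2 ^ t \<le> card (R w)" by (rule many[OF w])
      \<comment> \<open>Two disjoint sets of at least \<open>2 ^ t\<close> constraints would exceed
        the fewer than \<open>2 ^ Suc t\<close> in \<open>J\<close>.\<close>
      have "R v \<inter> R w \<noteq> {}"
      proof
        assume "R v \<inter> R w = {}"
        then have "card (R v \<union> R w) = card (R v) + card (R w)"
          using J(1) by (intro card_Un_disjoint) (auto simp: R_def)
        moreover have "card (R v \<union> R w) \<le> card J"
          using J(1) by (intro card_mono) (auto simp: R_def)
        ultimately show False using Rv Rw Jcard by simp
      qed
      then obtain i k1 k2 a b where i: "i \<in> J" and
        a: "k1 \<le> D - 1" "(v, a) \<in> S ^^ k1" "tight i a" and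
        b: "k2 \<le> D - 1" "(w, b) \<in> S ^^ k2" "tight i b"
        unfolding R_def by blast
      let ?A' = "A \<inter> {x. tight i x}"
      have face: "halfspace_int ?A' (J - {i}) face_of ?P"
        using halfspace_int_face[OF Suc.prems(2) i] J by simp
      have "a \<in> vertices (halfspace_int A J)" "b \<in> vertices (halfspace_int A J)"
        using skeleton_relpow_vertices a(2) b(2) v w unfolding S_def J(2) by blast+
      then have ab: "a \<in> vertices (halfspace_int ?A' (J - {i}))"
        "b \<in> vertices (halfspace_int ?A' (J - {i}))"
        using vertex_in_tight_face[OF Suc.prems(2) i] a(3) b(3) by blast+
      have ne: "?A' \<noteq> {}" using ab vertices_subset halfspace_int_subset by blast
      have "aff_dim ?A' = aff_dim A - 1"
        using aff_dim_affine_Int_hyperplane[OF Suc.prems(2), of "fst i" "snd i"] i ne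
        unfolding J_def tight_def by auto
      then have dim: "aff_dim ?A' \<le> int d" using Suc.prems(4) by simp
      have "card (J - {i}) < 2 ^ Suc t"
        using Jcard card_Diff1_le[of J i] by linarith
      from Suc.IH[OF _ affine_Int_tight[OF Suc.prems(2)] this dim ab] J(1)
      obtain k3 where k3: "k3 + 2 \<le> D'" "(a, b) \<in> skeleton (halfspace_int ?A' (J - {i})) ^^ k3"
        by (auto simp: D'_def)
      then have "(a, b) \<in> S ^^ k3"
        using relpow_mono[OF skeleton_face_of[OF face]] unfolding S_def by blast
      moreover have "(b, w) \<in> S ^^ k2" using b(2) S_sym by blast
      \<comment> \<open>The path goes from \<open>v\<close> to \<open>a\<close>, inside the common
        face to \<open>b\<close>, and on to \<open>w\<close>.\<close>
      ultimately have "(v, w) \<in> S ^^ (k1 + k3 + k2)"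
        using a(2) by (auto simp: relpow_add)
      moreover have "k1 + k3 + k2 + 2 \<le> 2 * D + D'" using a(1) b(1) k3(1) by simp
      ultimately show ?thesis unfolding rec S_def by blast
    qed
  qed
qed

section \<open>From facets to inequalities\<close>

text \<open>In a minimal family of halfspaces each member cuts out a facet, and distinct members cut
  out distinct facets, so the family is as large as the set of facets.\<close>

lemma polyhedron_eq_halfspace_int:
  fixes P :: "'a::euclidean_space set"
  assumes "polyhedron P" "P \<noteq> {}"
  obtains I where "finite I" "card I \<le> card {F. F facet_of P}"
    "P = halfspace_int (affine hull P) I"
proof -
  obtain F where F: "finite F" "P = affine hull P \<inter> \<Inter>F"
    and half: "\<forall>h\<in>F. \<exists>a b. a \<noteq> 0 \<and> h = {x. a \<bullet> x \<le> b}"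
    and minimal: "\<And>F'. F' \<subset> F \<Longrightarrow> P \<subset> affine hull P \<inter> \<Inter>F'"
    using assms(1) polyhedron_Int_affine_minimal[of P] by auto
  obtain a b where ab: "\<And>h. h \<in> F \<Longrightarrow> a h \<noteq> 0 \<and> h = {x. a h \<bullet> x \<le> b h}"
    using half by metis
  let ?g = "\<lambda>h. P \<inter> {x. a h \<bullet> x = b h}"
  obtain p where "p \<in> rel_interior P"
    using assms polyhedron_imp_convex rel_interior_eq_empty by blast
  then have p: "p \<in> P" "\<And>h. h \<in> F \<Longrightarrow> a h \<bullet> p < b h"
    using rel_interior_polyhedron_explicit[OF F ab minimal] by auto
  have mem: "x \<in> P \<longleftrightarrow> x \<in> affine hull P \<and> (\<forall>h\<in>F. a h \<bullet> x \<le> b h)" for x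
  proof -
    have "x \<in> \<Inter>F \<longleftrightarrow> (\<forall>h\<in>F. a h \<bullet> x \<le> b h)" using ab by blast
    then show ?thesis using F(2) by blast
  qed
  have "inj_on ?g F"
  proof (rule inj_onI, rule ccontr)
    fix h h' assume h: "h \<in> F" "h' \<in> F" "?g h = ?g h'" "h \<noteq> h'"
    \<comment> \<open>By minimality some \<open>x\<close> violates \<open>h\<close> alone. The
      segment from the relative interior point \<open>p\<close> to \<open>x\<close> crosses the
      hyperplane of \<open>h\<close> at parameter \<open>s\<close>, where all other constraints are
      still strict; so that point lies on the facet of \<open>h\<close> but not on that of
      \<open>h'\<close>.\<close>
    have "F - {h} \<subset> F" using h by blast
    then obtain x where x: "x \<in> affine hull P" "x \<in> \<Inter>(F - {h})" "x \<notin> P"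
      using minimal[of "F - {h}"] by blast
    have xk: "a k \<bullet> x \<le> b k" if "k \<in> F" "k \<noteq> h" for k
      using x(2) ab that by blast
    then have xh: "b h < a h \<bullet> x" using x mem by force
    define s where "s = (b h - a h \<bullet> p) / (a h \<bullet> x - a h \<bullet> p)"
    have ph: "a h \<bullet> p < b h" using p h by blast
    have s: "0 < s" "s < 1" using xh ph by (auto simp: s_def field_simps)
    define y where "y = (1 - s) *\<^sub>R p + s *\<^sub>R x"
    have inner_y: "a k \<bullet> y = a k \<bullet> p + s * (a k \<bullet> x - a k \<bullet> p)" for k
      by (simp add: y_def inner_add_right algebra_simps)
    have yh: "a h \<bullet> y = b h" using xh ph by (simp add: inner_y s_def)
    have yk: "a k \<bullet> y < b k" if "k \<in> F" "k \<noteq> h" for k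
    proof -
      have "(1 - s) * (a k \<bullet> p) < (1 - s) * b k" "s * (a k \<bullet> x) \<le> s * b k"
        using p(2)[OF that(1)] xk[OF that] s by simp_all
      then show ?thesis unfolding inner_y by (simp add: algebra_simps)
    qed
    have "y \<in> affine hull P"
      unfolding y_def using p(1) x(1) by (intro mem_affine) (auto intro: hull_inc)
    then have "y \<in> P" using mem yh yk by (metis less_eq_real_def)
    then have "y \<in> ?g h'" using yh h(3) by blast
    then show False using yk[OF h(2)] h(4) by auto
  qed
  then have "card (?g ` F) = card F" by (rule card_image)
  moreover have "{C. C facet_of P} = ?g ` F"
    using facet_of_polyhedron_explicit[OF F ab minimal] by auto
  moreover have "card ((\<lambda>h. (a h, b h)) ` F) \<le> card F" by (rule card_image_le) fact
  moreover have "P = halfspace_int (affine hull P) ((\<lambda>h. (a h, b h)) ` F)"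
    using mem by (auto simp: halfspace_int_def)
  ultimately show thesis using that[of "(\<lambda>h. (a h, b h)) ` F"] F(1) by simp
qed

lemma Delta_u_le:
  assumes "n < 2 ^ t"
  shows "Delta_u TYPE('a::euclidean_space) d n \<le> enat (2 ^ (t + 1) * ((d + t) choose d))"
proof -
  have "edge_dist P v w \<le> enat (2 ^ (t + 1) * ((d + t) choose d))"
    if P: "polyhedron P" "aff_dim P = int d" "card {F. F facet_of P} = n"
      and vw: "v \<in> vertices P" "w \<in> vertices P" for P :: "'a set" and v w
  proof -
    have "P \<noteq> {}" using vw vertices_subset by blast
    then obtain I where I: "finite I" "card I \<le> n" "P = halfspace_int (affine hull P) I"
      using polyhedron_eq_halfspace_int[OF P(1)] P(3) by metis
    have "card I < 2 ^ t" using I assms by simp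
    moreover have "v \<in> vertices (halfspace_int (affine hull P) I)"
      "w \<in> vertices (halfspace_int (affine hull P) I)" using vw I(3) by simp_all
    ultimately obtain k where k: "k + 2 \<le> 2 ^ (t + 1) * ((d + t) choose d)"
      "(v, w) \<in> skeleton P ^^ k"
      using skeleton_distance_bound[OF I(1), of "affine hull P" t d v w] P(2) I(3) by auto
    have "edge_dist P v w \<le> enat k"
      unfolding edge_dist_def using k by (intro INF_lower) auto
    also have "\<dots> \<le> enat (2 ^ (t + 1) * ((d + t) choose d))" using k by simp
    finally show ?thesis .
  qed
  then show ?thesis
    unfolding Delta_u_def graph_diameter_def by (auto intro!: SUP_least)
qed

section \<open>Numerical estimates and the final bound\<close>

text \<open>A single term of the binomial expansion of \<open>(1 + x) ^ (d + t)\<close> is at most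
  the whole sum; then divide by \<open>x ^ d\<close>.\<close>

lemma binomial_add_le:
  fixes x :: real
  assumes "x > 0"
  shows "real ((d + t) choose d) \<le> (1 + x) ^ t * (1 + 1 / x) ^ d"
proof -
  have "real ((d + t) choose d) * x ^ d \<le> (\<Sum>k\<le>d + t. real ((d + t) choose k) * x ^ k)"
    using assms by (intro member_le_sum) auto
  also have "\<dots> = (1 + x) ^ (d + t)"
    using binomial_ring[of x 1 "d + t"] by (simp add: add.commute)
  finally have "real ((d + t) choose d) \<le> (1 + x) ^ (d + t) / x ^ d"
    using assms by (simp add: pos_le_divide_eq)
  also have "\<dots> = (1 + x) ^ t * ((1 + x) / x) ^ d"
    by (simp add: power_add power_divide)
  also have "(1 + x) / x = 1 + 1 / x" using assms by (simp add: field_simps)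
  finally show ?thesis .
qed

text \<open>With \<open>x = y\<^sup>2\<close>, the difference of the two sides vanishes at
  \<open>0\<close> and has derivative \<open>(1 - y)\<^sup>2 / (1 + y\<^sup>2)\<close>.\<close>

lemma ln_one_plus_le_sqrt:
  fixes x :: real
  assumes "x \<ge> 0"
  shows "ln (1 + x) \<le> sqrt x"
proof -
  let ?f = "\<lambda>y::real. y - ln (1 + y\<^sup>2)"
  have "?f 0 \<le> ?f (sqrt x)"
  proof (rule DERIV_nonneg_imp_nondecreasing[where f = ?f])
    show "0 \<le> sqrt x" using assms by simp
    fix y :: real
    have pos: "0 < 1 + y\<^sup>2" by (simp add: add_pos_nonneg)
    have "(?f has_real_derivative 1 - 2 * y / (1 + y\<^sup>2)) (at y)"
      using pos by (auto intro!: derivative_eq_intros simp: power2_eq_square)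
    moreover have "2 * y \<le> 1 + y\<^sup>2"
      using zero_le_power2[of "1 - y"] by (simp add: power2_diff)
    then have "0 \<le> 1 - 2 * y / (1 + y\<^sup>2)" using pos by simp
    ultimately show "\<exists>z. (?f has_real_derivative z) (at y) \<and> 0 \<le> z" by blast
  qed
  then show ?thesis using assms by simp
qed

text \<open>With \<open>s\<close> the square root of \<open>d * L\<close>, the two logarithmic terms
  are at most \<open>2 * s\<close> and \<open>s\<close>, while the lower bound on \<open>L\<close>
  makes \<open>\<epsilon> * L\<close> at least \<open>sqrt 32 * s\<close>. Since
  \<open>3 * s + 2 * ln 2\<close> has to fit below \<open>sqrt 32 * s * ln 2\<close>, the value of
  \<open>s\<close> must not be too small; \<open>d \<ge> 3\<close> and \<open>L \<ge> 1\<close> give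
  \<open>s \<ge> sqrt 3\<close>.\<close>

lemma ln_bound_estimate:
  fixes \<epsilon> d L t :: real
  assumes "\<epsilon> > 0" "d \<ge> 3" "L \<ge> 1" "L \<ge> 32 * d / \<epsilon>\<^sup>2" "0 \<le> t" "t \<le> L + 1"
  shows "2 * ln 2 + t * ln (1 + d / L) + d * ln (1 + L / d) \<le> \<epsilon> * (L * ln 2)"
proof -
  define q where "q = sqrt (d / L)"
  have q: "q \<ge> 0" "q\<^sup>2 = d / L" "q * q = d / L" using assms by (auto simp: q_def)
  define s where "s = L * q"
  have qs: "q \<le> s" unfolding s_def using assms(3) q by (simp add: mult_le_cancel_right1)
  have "s\<^sup>2 = L * (L * (q * q))" by (simp add: s_def power2_eq_square)
  also have "\<dots> = d * L" using assms by (simp add: q(3))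
  finally have s2: "3 \<le> s\<^sup>2" using assms mult_mono[of 3 d 1 L] by simp
  have "s \<ge> 0" using qs q by linarith
  \<comment> \<open>\<open>1732 / 1000\<close> and \<open>5656 / 1000\<close> are rational lower
    approximations of \<open>sqrt 3\<close> and \<open>sqrt 32\<close>, precise enough for the tight
    final comparison with \<open>2 / 3\<close> in place of \<open>ln 2\<close>.\<close>
  have "(1732 / 1000)\<^sup>2 \<le> (3::real)" by (simp add: power2_eq_square)
  then have s: "1732 / 1000 \<le> s"
    using s2 \<open>s \<ge> 0\<close> by (meson order_trans power2_le_imp_le)
  have "d / L \<le> \<epsilon>\<^sup>2 / 32" using assms by (simp add: field_simps)
  moreover have "(5656 / 1000 * q)\<^sup>2 \<le> 32 * (d / L)"
    unfolding power_mult_distrib q(2)[symmetric]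
    by (intro mult_right_mono) (simp_all add: power2_eq_square)
  ultimately have "(5656 / 1000 * q)\<^sup>2 \<le> \<epsilon>\<^sup>2" by linarith
  then have "5656 / 1000 * q \<le> \<epsilon>" by (rule power2_le_imp_le) (use assms(1) in simp)
  then have "L * (5656 / 1000 * q) \<le> L * \<epsilon>" by (rule mult_left_mono) (use assms(3) in simp)
  then have eps: "5656 / 1000 * s \<le> L * \<epsilon>" by (simp add: s_def mult_ac)
  have ln2: "2 / 3 \<le> ln (2::real)" by (rule ln2_ge_two_thirds)
  have "t * ln (1 + d / L) \<le> (L + 1) * q"
    using assms ln_one_plus_le_sqrt[of "d / L"] by (intro mult_mono) (auto simp: q_def)
  also have "\<dots> = s + q" by (simp add: s_def algebra_simps)
  finally have 1: "t * ln (1 + d / L) \<le> 2 * s" using qs by linarith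
  have "d * ln (1 + L / d) \<le> d * sqrt (L / d)"
    using assms ln_one_plus_le_sqrt[of "L / d"] by (intro mult_left_mono) auto
  also have "sqrt (L / d) = 1 / q" by (simp add: q_def real_sqrt_divide)
  also have "d * (1 / q) = s"
  proof -
    have "q \<noteq> 0" using assms by (simp add: q_def)
    moreover have "d = L * (q * q)" using q assms by simp
    ultimately show ?thesis by (simp add: s_def)
  qed
  finally have 2: "d * ln (1 + L / d) \<le> s" .
  have "3 * s \<le> 2 / 3 * (5656 / 1000 * s - 2)" using s by simp
  also have "\<dots> \<le> ln 2 * (5656 / 1000 * s - 2)" using s ln2 by (intro mult_right_mono) auto
  also have "\<dots> \<le> ln 2 * (L * \<epsilon> - 2)" using eps by (intro mult_left_mono) auto
  finally show ?thesis using 1 2 by (simp add: algebra_simps)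
qed

theorem theorem7p4:
  fixes \<epsilon> :: real and d n :: nat
  assumes "\<epsilon> > 0" and "d \<ge> 3"
    and "real n \<ge> 2 powr (32 * real d / \<epsilon>\<^sup>2)"
  shows "ereal_of_enat (Delta_u TYPE('a::euclidean_space) d n) \<le> ereal (real n powr (1 + \<epsilon>))"
proof -
  have "(2::real) powr 0 < 2 powr (32 * real d / \<epsilon>\<^sup>2)"
    using assms by (intro powr_less_mono) auto
  then have n2: "n \<ge> 2" using assms(3) by simp
  define L where "L = log 2 (real n)"
  have L1: "1 \<le> L" using n2 by (simp add: L_def le_log_iff)
  have L2: "32 * real d / \<epsilon>\<^sup>2 \<le> L" using assms(3) n2 by (simp add: L_def le_log_iff)
  have lnn: "ln (real n) = L * ln 2" by (simp add: L_def log_def)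
  \<comment> \<open>The least \<open>t\<close> with \<open>n < 2 ^ t\<close>; hence
    \<open>2 ^ (t + 1)\<close> is at most \<open>4 * n\<close>, the leading factor of
    \<open>B\<close>.\<close>
  define t where "t = Suc (floor_log n)"
  have t: "n < 2 ^ t" "2 ^ t \<le> 2 * n"
    using n2 floor_log_exp2_le[of n] floor_log_exp2_gt[of n] by (auto simp: t_def)
  have "real (2 ^ t) \<le> real (2 * n)" using t(2) by (rule of_nat_mono)
  then have t': "(2::real) ^ t \<le> 2 * real n" by simp
  then have "log 2 (2 ^ t) \<le> log 2 (2 * real n)" by (intro log_mono) auto
  then have tL: "real t \<le> L + 1" using n2 by (simp add: L_def log_mult)
  have pos: "0 < real d / L" "0 < L / real d" using L1 assms(2) by auto
  define B where "B = 4 * real n * ((1 + real d / L) ^ t * (1 + L / real d) ^ d)"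
  have "2 ^ (t + 1) * real ((d + t) choose d) \<le> B"
    unfolding B_def
    using t' binomial_add_le[OF pos(1), of d t] by (intro mult_mono) auto
  moreover have "B \<le> real n powr (1 + \<epsilon>)"
  proof -
    have B: "B > 0" using pos n2 by (auto simp: B_def intro!: mult_pos_pos)
    have "ln B = ln (4 * real n) + (real t * ln (1 + real d / L) + real d * ln (1 + L / real d))"
      unfolding B_def using pos n2 by (simp add: ln_mult ln_realpow add_pos_pos)
    also have "ln (4 * real n) = 2 * ln 2 + ln (real n)"
      using n2 ln_realpow[of 2 2] by (simp add: ln_mult)
    \<comment> \<open>The factor \<open>n\<close> of \<open>B\<close> supplies the exponent
      \<open>1\<close>; the constant \<open>4\<close> and the binomial factor are absorbed by
      \<open>n powr \<epsilon>\<close>.\<close>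
    finally have "ln B \<le> ln (real n) + \<epsilon> * (L * ln 2)"
      using ln_bound_estimate[of \<epsilon> "real d" L "real t"] assms L1 L2 tL by simp
    also have "\<dots> = (1 + \<epsilon>) * ln (real n)" by (simp add: lnn algebra_simps)
    also have "\<dots> = ln (real n powr (1 + \<epsilon>))" using n2 by (simp add: ln_powr)
    finally have "ln B \<le> ln (real n powr (1 + \<epsilon>))" .
    moreover have "0 < real n powr (1 + \<epsilon>)" using n2 by simp
    ultimately show ?thesis using ln_le_cancel_iff[OF B] by blast
  qed
  ultimately have "real (2 ^ (t + 1) * ((d + t) choose d)) \<le> real n powr (1 + \<epsilon>)" by simp
  moreover have "ereal_of_enat (Delta_u TYPE('a) d n)
      \<le> ereal_of_enat (enat (2 ^ (t + 1) * ((d + t) choose d)))"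
    using Delta_u_le[OF t(1)] by (simp only: ereal_of_enat_le_iff)
  ultimately show ?thesis
    by (metis (no_types, lifting) ereal_less_eq(3) ereal_of_enat_simps(1) order_trans)
qed

end
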